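(* Let $x\in\left(0,\sum_{i=1}^n\bar v_i\right)$. Consider the strategy-flow problem $$(P_1)\qquad \min_{h}\ \sum_{s\in\mathcal S}h_s\,T_s(v(h))\quad\text{s.t. } h_s\ge 0\ (s\in\mathcal S),\quad \sum_{s\in\mathcal S}h_s=x,$$ and the line-flow problem $$(P_2)\qquad \min_{v,\alpha}\ \sum_{i=1}^n t_iv_i+\alpha\quad\text{s.t. } v_i\ge 0\ (i=1,\dots,n),\quad \sum_{i=1}^n v_i=x,\quad \frac{v_i}{f_i(v_i)}\le\alpha\ (i=1,\dots,n),$$ where $v_i\in[0,\bar v_i)$. Then $(P_1)$ and $(P_2)$ are equivalent: their optimal values coincide; if $h$ is optimal for $(P_1)$ then $\left(v(h),\max_i \frac{v_i(h)}{f_i(v_i(h))}\right)$ is optimal for $(P_2)$; and if $(v,\alpha)$ is optimal for $(P_2)$ then there is an optimal solution $h$ of $(P_1)$ with $v(h)=v$.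
   Context: An origin is connected to a destination by $n$ bus lines $1,\dots,n$. Line $i$ has a constant in-vehicle travel time $t_i\ge 0$, a saturation flow $\bar v_i\in(0,\infty]$, and a smooth effective frequency function $f_i:[0,\bar v_i)\to(0,\infty)$ with $f_i'(v)<0$ for all $v$ and $f_i(v)\to 0$ as $v\to\bar v_i$. $\mathcal S$ is the set of nonempty subsets of $\{1,\dots,n\}$ (strategies). A strategy-flow vector $h=(h_s)_{s\in\mathcal S}\ge 0$ induces a unique line-flow vector $v=v(h)$, $v_i\in[0,\bar v_i)$, through the system $v_i=\sum_{s\ni i}h_s\,\frac{f_i(v_i)}{\sum_{j\in s}f_j(v_j)}$, $i=1,\dots,n$ (only those $h$ for which this system is solvable are considered in $(P_1)$). The expected transit time of strategy $s$ is $T_s(v)=\frac{1+\sum_{i\in s}t_if_i(v_i)}{\sum_{i\in s}f_i(v_i)}$. *)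

theory Defs
  imports Complex_Main "HOL-Library.Extended_Real"
begin

text \<open>
  The lines are the elements of a finite type \<open>'n\<close>. A saturation flow in \<open>(0, \<infinity>]\<close> is
  an \<open>ereal\<close>, and every effective frequency function is used only on its interval
  \<open>[0, c)\<close>; derivatives are taken within that interval, hence one-sided at \<open>0\<close>.
\<close>

definition flow_range :: "ereal \<Rightarrow> real set" where
  "flow_range c = {u. 0 \<le> u \<and> ereal u < c}"

definition smooth_on :: "real set \<Rightarrow> (real \<Rightarrow> real) \<Rightarrow> bool" where
  "smooth_on I g \<longleftrightarrow> (\<exists>D :: nat \<Rightarrow> real \<Rightarrow> real.
     (\<forall>u\<in>I. D 0 u = g u) \<and>
     (\<forall>k. \<forall>u\<in>I. (D k has_real_derivative D (Suc k) u) (at u within I)))"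

definition effective_frequency :: "ereal \<Rightarrow> (real \<Rightarrow> real) \<Rightarrow> bool" where
  "effective_frequency c g \<longleftrightarrow>
     (\<forall>u\<in>flow_range c. 0 < g u) \<and>
     smooth_on (flow_range c) g \<and>
     (\<forall>u\<in>flow_range c. \<exists>D<0. (g has_real_derivative D) (at u within flow_range c)) \<and>
     ((g \<circ> real_of_ereal) \<longlongrightarrow> 0) (at_left c)"

definition strategies :: "'n set set" where
  "strategies = {s. s \<noteq> {}}"

definition is_line_flow ::
  "('n::finite \<Rightarrow> ereal) \<Rightarrow> ('n \<Rightarrow> real \<Rightarrow> real) \<Rightarrow> ('n set \<Rightarrow> real) \<Rightarrow> ('n \<Rightarrow> real) \<Rightarrow> bool" where
  "is_line_flow vbar f h v \<longleftrightarrow>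
     (\<forall>i. v i \<in> flow_range (vbar i)) \<and>
     (\<forall>i. v i = (\<Sum>s | s \<in> strategies \<and> i \<in> s. h s * (f i (v i) / (\<Sum>j\<in>s. f j (v j)))))"

definition line_flow ::
  "('n::finite \<Rightarrow> ereal) \<Rightarrow> ('n \<Rightarrow> real \<Rightarrow> real) \<Rightarrow> ('n set \<Rightarrow> real) \<Rightarrow> ('n \<Rightarrow> real)" where
  "line_flow vbar f h = (THE v. is_line_flow vbar f h v)"

definition transit_time ::
  "('n::finite \<Rightarrow> real) \<Rightarrow> ('n \<Rightarrow> real \<Rightarrow> real) \<Rightarrow> 'n set \<Rightarrow> ('n \<Rightarrow> real) \<Rightarrow> real" where
  "transit_time t f s v = (1 + (\<Sum>i\<in>s. t i * f i (v i))) / (\<Sum>i\<in>s. f i (v i))"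

text \<open>The value \<open>h {}\<close> is never used: the empty set is not a strategy.\<close>

definition P1_feasible ::
  "('n::finite \<Rightarrow> ereal) \<Rightarrow> ('n \<Rightarrow> real \<Rightarrow> real) \<Rightarrow> real \<Rightarrow> ('n set \<Rightarrow> real) \<Rightarrow> bool" where
  "P1_feasible vbar f x h \<longleftrightarrow>
     (\<forall>s\<in>strategies. 0 \<le> h s) \<and> (\<Sum>s\<in>strategies. h s) = x \<and>
     (\<exists>v. is_line_flow vbar f h v)"

definition P1_cost ::
  "('n::finite \<Rightarrow> real) \<Rightarrow> ('n \<Rightarrow> ereal) \<Rightarrow> ('n \<Rightarrow> real \<Rightarrow> real) \<Rightarrow> ('n set \<Rightarrow> real) \<Rightarrow> real" where
  "P1_cost t vbar f h = (\<Sum>s\<in>strategies. h s * transit_time t f s (line_flow vbar f h))"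

definition P2_feasible ::
  "('n::finite \<Rightarrow> ereal) \<Rightarrow> ('n \<Rightarrow> real \<Rightarrow> real) \<Rightarrow> real \<Rightarrow> ('n \<Rightarrow> real) \<times> real \<Rightarrow> bool" where
  "P2_feasible vbar f x = (\<lambda>(v, \<alpha>).
     (\<forall>i. v i \<in> flow_range (vbar i)) \<and> (\<Sum>i\<in>UNIV. v i) = x \<and>
     (\<forall>i. v i / f i (v i) \<le> \<alpha>))"

definition P2_cost :: "('n::finite \<Rightarrow> real) \<Rightarrow> ('n \<Rightarrow> real) \<times> real \<Rightarrow> real" where
  "P2_cost t = (\<lambda>(v, \<alpha>). (\<Sum>i\<in>UNIV. t i * v i) + \<alpha>)"

text \<open>The infimum in \<open>ereal\<close>, so that no default value of a real \<open>Inf\<close> can intervene.\<close>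

definition optimal_value :: "('a \<Rightarrow> real) \<Rightarrow> ('a \<Rightarrow> bool) \<Rightarrow> ereal" where
  "optimal_value J F = (INF y\<in>Collect F. ereal (J y))"

end

theory Submission
  imports Defs
begin

text \<open>
  If \<open>h\<close> has line flow \<open>v\<close>, put \<open>F\<^sub>s = \<Sum>j\<in>s. f\<^sub>j (v\<^sub>j)\<close> and \<open>g\<^sub>s = h\<^sub>s / F\<^sub>s\<close>. The defining
  system says \<open>v\<^sub>i / f\<^sub>i (v\<^sub>i) = (\<Sum>s\<ni>i. g\<^sub>s)\<close>, and the cost of \<open>h\<close> is
  \<open>(\<Sum>i. t\<^sub>i v\<^sub>i) + (\<Sum>s. g\<^sub>s)\<close>. Hence \<open>\<Sum>s. g\<^sub>s\<close> bounds every \<open>v\<^sub>i / f\<^sub>i (v\<^sub>i)\<close>, and passing from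
  \<open>h\<close> to \<open>(v, max\<^sub>i v\<^sub>i / f\<^sub>i (v\<^sub>i))\<close> does not increase the cost. Conversely, any nonnegative vector
  \<open>y\<close> is a nonnegative combination of indicators of nested sets (its superlevel sets) with total
  weight \<open>max\<^sub>i y\<^sub>i\<close>; for \<open>y\<^sub>i = v\<^sub>i / f\<^sub>i (v\<^sub>i)\<close> the weights \<open>g\<close> yield a strategy flow
  \<open>h\<^sub>s = g\<^sub>s F\<^sub>s\<close> with line flow \<open>v\<close> whose cost is at most that of \<open>(v, \<alpha>)\<close>.
\<close>

section \<open>Positivity and monotonicity of effective frequencies\<close>

lemma effective_frequency_pos:
  assumes "effective_frequency c g" "u \<in> flow_range c"
  shows "0 < g u"
  using assms by (simp add: effective_frequency_def)

lemma effective_frequency_strict_antimono: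
  assumes "effective_frequency c g" and "u \<in> flow_range c" "w \<in> flow_range c" "u < w"
  shows "g w < g u"
proof -
  have sub: "{u..w} \<subseteq> flow_range c"
  proof
    fix z assume z: "z \<in> {u..w}"
    then have "ereal z \<le> ereal w" by simp
    also have "\<dots> < c" using assms(3) by (simp add: flow_range_def)
    finally show "z \<in> flow_range c" using z assms(2) by (simp add: flow_range_def)
  qed
  have D: "\<exists>D<0. (g has_real_derivative D) (at z within flow_range c)" if "z \<in> flow_range c" for z
    using assms(1) that by (simp add: effective_frequency_def)
  have "continuous_on (flow_range c) g"
    unfolding continuous_on_eq_continuous_within using D DERIV_continuous by blast
  then have "continuous_on {u..w} g"
    using sub continuous_on_subset by blast
  moreover have "\<exists>y. (g has_real_derivative y) (at z) \<and> y < 0" if "u < z" "z < w" for z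
  proof -
    \<comment> \<open>Strictly between \<open>u\<close> and \<open>w\<close> the derivative within
      the range is the ordinary one; at the endpoints, where it may be one-sided, continuity
      suffices.\<close>
    have "at z within flow_range c = at z"
      by (rule at_within_open_subset[of _ "{u<..<w}"]) (use that sub in auto)
    moreover have "z \<in> flow_range c" using that sub by auto
    ultimately show ?thesis using D[of z] by auto
  qed
  ultimately show ?thesis
    using DERIV_neg_imp_decreasing_open[OF \<open>u < w\<close>, of g] by blast
qed

section \<open>Uniqueness of the line flow\<close>

text \<open>Cross-multiplication reduces the claim to \<open>a * b' \<le> a' * b\<close>. Here
  \<open>a\<close> and \<open>b\<close> stand for the frequency sums of a strategy inside and
  outside a set of lines.\<close>

lemma share_mono:
  fixes a a' b b' :: real
  assumes "0 \<le> a" "a \<le> a'" "0 \<le> b'" "b' \<le> b" "0 < a + b" "0 < a' + b'"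
  shows "a / (a + b) \<le> a' / (a' + b')"
proof -
  have "a * b' \<le> a' * b" using assms by (intro mult_mono) auto
  then show ?thesis using assms by (simp add: divide_simps algebra_simps)
qed

lemma sum_strategies_swap:
  fixes p :: "'n::finite \<Rightarrow> 'n set \<Rightarrow> real"
  shows "(\<Sum>i\<in>A. \<Sum>s | s \<in> strategies \<and> i \<in> s. p i s) = (\<Sum>s\<in>strategies. \<Sum>i\<in>s \<inter> A. p i s)"
proof -
  have "(\<Sum>i\<in>A. \<Sum>s | s \<in> strategies \<and> i \<in> s. p i s) = (\<Sum>s\<in>strategies. \<Sum>i | i \<in> A \<and> i \<in> s. p i s)"
    by (rule sum.swap_restrict) auto
  also have "\<dots> = (\<Sum>s\<in>strategies. \<Sum>i\<in>s \<inter> A. p i s)"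
    by (intro sum.cong) auto
  finally show ?thesis .
qed

text \<open>
  Every strategy sends at most as large a share of its flow to the lines \<open>A = {i. w i < v i}\<close>
  under \<open>v\<close> as under \<open>w\<close>, because on \<open>A\<close> the frequencies are lower under \<open>v\<close> and off \<open>A\<close> higher.
\<close>
lemma is_line_flow_le:
  fixes v w :: "'n::finite \<Rightarrow> real"
  assumes ef: "\<And>i. effective_frequency (vbar i) (f i)"
    and h: "\<And>s. s \<in> strategies \<Longrightarrow> 0 \<le> h s"
    and v: "is_line_flow vbar f h v" and w: "is_line_flow vbar f h w"
  shows "v i \<le> w i"
proof (rule ccontr)
  assume "\<not> v i \<le> w i"
  define A where "A = {i. w i < v i}"
  have rv: "v i \<in> flow_range (vbar i)" and rw: "w i \<in> flow_range (vbar i)" for i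
    using v w by (auto simp: is_line_flow_def)
  have pv: "0 < f i (v i)" and pw: "0 < f i (w i)" for i
    using ef rv rw effective_frequency_pos by blast+
  have inA: "f i (v i) \<le> f i (w i)" if "i \<in> A" for i
    using that effective_frequency_strict_antimono[OF ef rw rv] by (force simp: A_def)
  have notA: "f i (w i) \<le> f i (v i)" if "i \<notin> A" for i
    using that effective_frequency_strict_antimono[OF ef rv rw, of i]
      by (cases "v i = w i") (force simp: A_def)+
  have flow: "(\<Sum>i\<in>A. u i)
      = (\<Sum>s\<in>strategies. h s * ((\<Sum>i\<in>s \<inter> A. f i (u i)) / (\<Sum>j\<in>s. f j (u j))))"
    if "is_line_flow vbar f h u" for u
  proof -
    have "(\<Sum>i\<in>A. u i)
        = (\<Sum>i\<in>A. \<Sum>s | s \<in> strategies \<and> i \<in> s. h s * (f i (u i) / (\<Sum>j\<in>s. f j (u j))))"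
      using that by (intro sum.cong) (auto simp: is_line_flow_def)
    then show ?thesis
      by (simp add: sum_strategies_swap sum_distrib_left sum_divide_distrib)
  qed
  have "(\<Sum>i\<in>A. v i) \<le> (\<Sum>i\<in>A. w i)"
    unfolding flow[OF v] flow[OF w]
  proof (intro sum_mono mult_left_mono h)
    fix s :: "'n set" assume s: "s \<in> strategies"
    have split: "(\<Sum>j\<in>s. p j) = (\<Sum>j\<in>s \<inter> A. p j) + (\<Sum>j\<in>s - A. p j)" for p :: "'n \<Rightarrow> real"
      by (rule sum.Int_Diff) simp
    have "0 < (\<Sum>j\<in>s. f j (v j))" "0 < (\<Sum>j\<in>s. f j (w j))"
      using s pv pw by (auto simp: strategies_def intro!: sum_pos)
    then show "(\<Sum>i\<in>s \<inter> A. f i (v i)) / (\<Sum>j\<in>s. f j (v j))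
        \<le> (\<Sum>i\<in>s \<inter> A. f i (w i)) / (\<Sum>j\<in>s. f j (w j))"
      unfolding split using inA notA pv pw
      by (intro share_mono sum_mono sum_nonneg) (auto intro: less_imp_le)
  qed auto
  moreover have "(\<Sum>i\<in>A. w i) < (\<Sum>i\<in>A. v i)"
    using \<open>\<not> v i \<le> w i\<close> by (intro sum_strict_mono) (auto simp: A_def not_le)
  ultimately show False by simp
qed

text \<open>Comparing two solutions in both directions gives uniqueness, so the definite description
  in \<open>line_flow\<close> denotes the solution whenever there is one.\<close>

lemma line_flow_eq:
  fixes v :: "'n::finite \<Rightarrow> real"
  assumes "\<And>i. effective_frequency (vbar i) (f i)"
    and "\<And>s. s \<in> strategies \<Longrightarrow> 0 \<le> h s"
    and "is_line_flow vbar f h v"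
  shows "line_flow vbar f h = v"
  unfolding line_flow_def
  by (rule the_equality) (use assms is_line_flow_le[of vbar f h] in \<open>auto intro!: ext antisym\<close>)

section \<open>Total flow and cost as sums over strategies\<close>

text \<open>The weights \<open>t\<close> are arbitrary: travel times give the in-vehicle part of the
  cost, the constant 1 gives the total flow.\<close>

lemma is_line_flow_sum:
  fixes v :: "'n::finite \<Rightarrow> real"
  assumes "is_line_flow vbar f h v"
  shows "(\<Sum>i\<in>UNIV. t i * v i) =
    (\<Sum>s\<in>strategies. h s * ((\<Sum>i\<in>s. t i * f i (v i)) / (\<Sum>j\<in>s. f j (v j))))"
proof -
  have "(\<Sum>i\<in>UNIV. t i * v i)
      = (\<Sum>i\<in>UNIV. t i * (\<Sum>s | s \<in> strategies \<and> i \<in> s. h s * (f i (v i) / (\<Sum>j\<in>s. f j (v j)))))"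
    using assms unfolding is_line_flow_def by (metis (no_types, lifting))
  also have "\<dots> = (\<Sum>i\<in>UNIV. \<Sum>s | s \<in> strategies \<and> i \<in> s. t i * (h s * (f i (v i) / (\<Sum>j\<in>s. f j (v j)))))"
    by (simp add: sum_distrib_left)
  also have "\<dots> = (\<Sum>s\<in>strategies. \<Sum>i\<in>s. t i * (h s * (f i (v i) / (\<Sum>j\<in>s. f j (v j)))))"
    by (simp add: sum_strategies_swap)
  finally show ?thesis
    by (simp add: sum_distrib_left sum_divide_distrib mult_ac)
qed

lemma is_line_flow_total:
  fixes v :: "'n::finite \<Rightarrow> real"
  assumes "\<And>i. 0 < f i (v i)" and "is_line_flow vbar f h v"
  shows "(\<Sum>i\<in>UNIV. v i) = (\<Sum>s\<in>strategies. h s)"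
proof -
  have "0 < (\<Sum>j\<in>s. f j (v j))" if "s \<in> strategies" for s
    using that assms(1) by (auto simp: strategies_def intro!: sum_pos)
  then have "(\<Sum>s\<in>strategies. h s * ((\<Sum>i\<in>s. f i (v i)) / (\<Sum>j\<in>s. f j (v j)))) = (\<Sum>s\<in>strategies. h s)"
    by (intro sum.cong) force+
  then show ?thesis
    using is_line_flow_sum[OF assms(2), of "\<lambda>_. 1"] by simp
qed

text \<open>The summand 1 in the numerator of \<open>transit_time\<close> is the source of the
  waiting term \<open>h s / F\<^sub>s\<close>.\<close>

lemma transit_cost_eq:
  fixes v :: "'n::finite \<Rightarrow> real"
  assumes "is_line_flow vbar f h v"
  shows "(\<Sum>s\<in>strategies. h s * transit_time t f s v) =
    (\<Sum>i\<in>UNIV. t i * v i) + (\<Sum>s\<in>strategies. h s / (\<Sum>j\<in>s. f j (v j)))"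
  unfolding is_line_flow_sum[OF assms] transit_time_def
  by (simp add: sum.distrib[symmetric] add_divide_distrib distrib_left add.commute)

text \<open>Dividing by \<open>f i (v i)\<close> turns the system, for fixed \<open>v\<close>, into
  linear equations in the weights \<open>h s / F\<^sub>s\<close>.\<close>

lemma is_line_flow_iff_ratio:
  fixes v :: "'n::finite \<Rightarrow> real"
  assumes "\<And>i. 0 < f i (v i)" and "\<And>i. v i \<in> flow_range (vbar i)"
  shows "is_line_flow vbar f h v \<longleftrightarrow>
    (\<forall>i. v i / f i (v i) = (\<Sum>s | s \<in> strategies \<and> i \<in> s. h s / (\<Sum>j\<in>s. f j (v j))))"
proof -
  have "(\<Sum>s | s \<in> strategies \<and> i \<in> s. h s * (f i (v i) / (\<Sum>j\<in>s. f j (v j))))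
      = (\<Sum>s | s \<in> strategies \<and> i \<in> s. h s / (\<Sum>j\<in>s. f j (v j))) * f i (v i)" for i
    by (simp add: sum_distrib_right)
  then show ?thesis
    using assms by (simp add: is_line_flow_def divide_eq_eq less_imp_neq[THEN not_sym])
qed

section \<open>Decomposition of a nonnegative vector into layers\<close>

text \<open>Induction on the size of the support \<open>S\<close>: the smallest positive value
  \<open>m\<close> is subtracted on \<open>S\<close> and becomes additional weight of the strategy
  \<open>S\<close>. The total weight, being some coordinate, is bounded by any upper bound of
  \<open>y\<close>.\<close>

lemma layer_decomposition:
  fixes y :: "'n::finite \<Rightarrow> real"
  assumes "\<And>i. 0 \<le> y i"
  shows "\<exists>g. (\<forall>s. 0 \<le> g s) \<and> (\<forall>i. (\<Sum>s | s \<in> strategies \<and> i \<in> s. g s) = y i)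
    \<and> (\<exists>i. (\<Sum>s\<in>strategies. g s) = y i)"
  using assms
proof (induction "card {i. 0 < y i}" arbitrary: y rule: less_induct)
  case less
  define S where "S = {i. 0 < y i}"
  show ?case
  proof (cases "S = {}")
    case True
    then have "y i = 0" for i
      using less.prems[of i] by (auto simp: S_def not_less intro: antisym)
    then show ?thesis by (intro exI[of _ "\<lambda>_. 0"]) auto
  next
    case False
    define m where "m = Min (y ` S)"
    have "m \<in> y ` S" using False by (auto simp: m_def intro!: Min_in)
    then obtain k where k: "k \<in> S" "m = y k" by auto
    have m_pos: "0 < m" using k by (simp add: S_def)
    have m_le: "m \<le> y i" if "i \<in> S" for i using that by (auto simp: m_def)
    have y0: "y i = 0" if "i \<notin> S" for i
      using that less.prems[of i] by (auto simp: S_def)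
    define y' where "y' i = y i - (if i \<in> S then m else 0)" for i
    have y'_nonneg: "0 \<le> y' i" for i using m_le less.prems by (simp add: y'_def)
    \<comment> \<open>The coordinate \<open>k\<close>, where the minimum is attained, drops to
      0.\<close>
    have "{i. 0 < y' i} \<subset> {i. 0 < y i}"
      using k m_pos by (auto simp: y'_def S_def split: if_splits)
    then have "card {i. 0 < y' i} < card {i. 0 < y i}" by (intro psubset_card_mono) auto
    from less.hyps[OF this y'_nonneg] obtain g l where g: "\<And>s. 0 \<le> g s"
      and gi: "\<And>i. (\<Sum>s | s \<in> strategies \<and> i \<in> s. g s) = y' i"
      and gl: "(\<Sum>s\<in>strategies. g s) = y' l" by blast
    define g' where "g' s = g s + (if s = S then m else 0)" for s
    have S: "S \<in> strategies" using False by (simp add: strategies_def)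
    have "(\<Sum>s | s \<in> strategies \<and> i \<in> s. g' s) = y i" for i
      using S by (simp add: g'_def sum.distrib gi sum.delta y'_def)
    moreover have "(\<Sum>s\<in>strategies. g' s) = y' l + m"
      using S by (simp add: g'_def sum.distrib gl sum.delta)
    \<comment> \<open>For \<open>l\<close> in \<open>S\<close> the coordinate is \<open>l\<close>
      itself; otherwise \<open>y' l = 0\<close> and the total is \<open>m = y k\<close>.\<close>
    moreover have "\<exists>i. y' l + m = y i"
    proof (cases "l \<in> S")
      case True
      then show ?thesis by (auto simp: y'_def)
    next
      case False
      then show ?thesis using k by (auto simp: y'_def y0)
    qed
    moreover have "0 \<le> g' s" for s using g m_pos by (simp add: g'_def)
    ultimately show ?thesis by metis
  qed
qed

section \<open>Passage between the two problems without increase of cost\<close>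

lemma P1_imp_P2:
  fixes h :: "'n::finite set \<Rightarrow> real"
  assumes ef: "\<And>i. effective_frequency (vbar i) (f i)" and h: "P1_feasible vbar f x h"
  defines "v \<equiv> line_flow vbar f h"
  defines "\<alpha> \<equiv> MAX i. v i / f i (v i)"
  shows "P2_feasible vbar f x (v, \<alpha>)" and "P2_cost t (v, \<alpha>) \<le> P1_cost t vbar f h"
proof -
  have h0: "\<And>s. s \<in> strategies \<Longrightarrow> 0 \<le> h s"
    using h by (simp add: P1_feasible_def)
  have flow: "is_line_flow vbar f h v"
    using h line_flow_eq[of vbar f h, OF ef h0] by (auto simp: P1_feasible_def v_def)
  then have range: "v i \<in> flow_range (vbar i)" for i by (simp add: is_line_flow_def)
  then have pos: "0 < f i (v i)" for i using ef effective_frequency_pos by blast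
  show "P2_feasible vbar f x (v, \<alpha>)"
    using range is_line_flow_total[of f v, OF pos flow] h
    by (simp add: P2_feasible_def P1_feasible_def \<alpha>_def)
  have "v i / f i (v i) \<le> (\<Sum>s\<in>strategies. h s / (\<Sum>j\<in>s. f j (v j)))" for i
  proof -
    have "v i / f i (v i) = (\<Sum>s | s \<in> strategies \<and> i \<in> s. h s / (\<Sum>j\<in>s. f j (v j)))"
      using is_line_flow_iff_ratio[of f v vbar h, OF pos range] flow by blast
    \<comment> \<open>The strategies that avoid \<open>i\<close> only add nonnegative terms.\<close>
    also have "\<dots> \<le> (\<Sum>s\<in>strategies. h s / (\<Sum>j\<in>s. f j (v j)))"
      using h0 pos by (intro sum_mono2) (auto intro!: divide_nonneg_nonneg sum_nonneg intro: less_imp_le)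
    finally show ?thesis .
  qed
  then have "\<alpha> \<le> (\<Sum>s\<in>strategies. h s / (\<Sum>j\<in>s. f j (v j)))" by (auto simp: \<alpha>_def)
  then show "P2_cost t (v, \<alpha>) \<le> P1_cost t vbar f h"
    using transit_cost_eq[OF flow, of t] by (simp add: P2_cost_def P1_cost_def v_def)
qed

lemma P2_imp_P1:
  fixes v :: "'n::finite \<Rightarrow> real"
  assumes ef: "\<And>i. effective_frequency (vbar i) (f i)" and v: "P2_feasible vbar f x (v, \<alpha>)"
  obtains h where "P1_feasible vbar f x h" "line_flow vbar f h = v"
    "P1_cost t vbar f h \<le> P2_cost t (v, \<alpha>)"
proof -
  have range: "v i \<in> flow_range (vbar i)" and bound: "v i / f i (v i) \<le> \<alpha>" for i
    using v by (auto simp: P2_feasible_def)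
  have pos: "0 < f i (v i)" for i using range ef effective_frequency_pos by blast
  have "0 \<le> v i / f i (v i)" for i
    using range[of i] pos[of i] by (simp add: flow_range_def)
  from layer_decomposition[of "\<lambda>i. v i / f i (v i)", OF this] obtain g k
    where g: "\<And>s. 0 \<le> g s"
      and gi: "\<And>i. (\<Sum>s | s \<in> strategies \<and> i \<in> s. g s) = v i / f i (v i)"
      and gk: "(\<Sum>s\<in>strategies. g s) = v k / f k (v k)" by blast
  define h where "h s = g s * (\<Sum>j\<in>s. f j (v j))" for s
  have F: "0 < (\<Sum>j\<in>s. f j (v j))" if "s \<in> strategies" for s
    using that pos by (auto simp: strategies_def intro!: sum_pos)
  have hg: "h s / (\<Sum>j\<in>s. f j (v j)) = g s" if "s \<in> strategies" for s
    using F[OF that] by (simp add: h_def)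
  have h0: "0 \<le> h s" if "s \<in> strategies" for s
    using g[of s] F[OF that] by (simp add: h_def)
  have flow: "is_line_flow vbar f h v"
    using is_line_flow_iff_ratio[of f v vbar h, OF pos range] by (simp add: hg gi)
  have lf: "line_flow vbar f h = v"
    using ef h0 flow by (rule line_flow_eq)
  show ?thesis
  proof
    show "P1_feasible vbar f x h"
      using h0 flow v is_line_flow_total[of f v, OF pos flow]
      by (auto simp: P1_feasible_def P2_feasible_def)
    show "line_flow vbar f h = v" by (fact lf)
    \<comment> \<open>The waiting term is the total weight of \<open>g\<close>, which is the ratio
      at \<open>k\<close> and hence at most \<alpha>.\<close>
    show "P1_cost t vbar f h \<le> P2_cost t (v, \<alpha>)"
      using transit_cost_eq[OF flow, of t] bound[of k]
      by (simp add: P1_cost_def P2_cost_def lf hg gk)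
  qed
qed

theorem mainTheorem2:
  fixes t :: "'n::finite \<Rightarrow> real"
    and vbar :: "'n \<Rightarrow> ereal"
    and f :: "'n \<Rightarrow> real \<Rightarrow> real"
    and x :: real
  assumes "\<And>i. 0 \<le> t i"
    and "\<And>i. 0 < vbar i"
    and "\<And>i. effective_frequency (vbar i) (f i)"
    and "0 < x"
    and "ereal x < (\<Sum>i\<in>UNIV. vbar i)"
  shows "optimal_value (P1_cost t vbar f) (P1_feasible vbar f x)
           = optimal_value (P2_cost t) (P2_feasible vbar f x)
    \<and> (\<forall>h. is_arg_min (P1_cost t vbar f) (P1_feasible vbar f x) h \<longrightarrow>
          is_arg_min (P2_cost t) (P2_feasible vbar f x)
            (line_flow vbar f h,
             MAX i. line_flow vbar f h i / f i (line_flow vbar f h i)))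
    \<and> (\<forall>v \<alpha>. is_arg_min (P2_cost t) (P2_feasible vbar f x) (v, \<alpha>) \<longrightarrow>
          (\<exists>h. is_arg_min (P1_cost t vbar f) (P1_feasible vbar f x) h \<and>
               line_flow vbar f h = v))"
proof -
  let ?\<Phi> = "\<lambda>h. (line_flow vbar f h, MAX i. line_flow vbar f h i / f i (line_flow vbar f h i))"
  have to2: "P2_feasible vbar f x (?\<Phi> h)" "P2_cost t (?\<Phi> h) \<le> P1_cost t vbar f h"
    if "P1_feasible vbar f x h" for h
    using P1_imp_P2[OF assms(3) that] by blast+
  have to1: "\<exists>h. P1_feasible vbar f x h \<and> line_flow vbar f h = fst p \<and>
      P1_cost t vbar f h \<le> P2_cost t p"
    if "P2_feasible vbar f x p" for p
    using P2_imp_P1[of vbar f x "fst p" "snd p" t, OF assms(3)] that by (metis prod.collapse)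
  have "optimal_value (P1_cost t vbar f) (P1_feasible vbar f x)
      = optimal_value (P2_cost t) (P2_feasible vbar f x)"
    unfolding optimal_value_def
  proof (rule antisym; rule INF_mono)
    fix p assume "p \<in> Collect (P2_feasible vbar f x)"
    then show "\<exists>h\<in>Collect (P1_feasible vbar f x). ereal (P1_cost t vbar f h) \<le> ereal (P2_cost t p)"
      using to1[of p] by auto
  next
    fix h assume "h \<in> Collect (P1_feasible vbar f x)"
    then show "\<exists>p\<in>Collect (P2_feasible vbar f x). ereal (P2_cost t p) \<le> ereal (P1_cost t vbar f h)"
      using to2[of h] by (intro bexI[of _ "?\<Phi> h"]) auto
  qed
  \<comment> \<open>Any feasible \<open>p\<close> comes with some \<open>h'\<close> no more
    expensive, so the costs increase weakly along \<open>?\<Phi> h\<close>, \<open>h\<close>,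
    \<open>h'\<close>, \<open>p\<close>.\<close>
  moreover have "is_arg_min (P2_cost t) (P2_feasible vbar f x) (?\<Phi> h)"
    if "is_arg_min (P1_cost t vbar f) (P1_feasible vbar f x) h" for h
    using that to2[of h] to1 unfolding is_arg_min_linorder by (meson order_trans)
  moreover have "\<exists>h. is_arg_min (P1_cost t vbar f) (P1_feasible vbar f x) h \<and> line_flow vbar f h = v"
    if opt: "is_arg_min (P2_cost t) (P2_feasible vbar f x) (v, \<alpha>)" for v \<alpha>
  proof -
    obtain h where h: "P1_feasible vbar f x h" "line_flow vbar f h = v"
      "P1_cost t vbar f h \<le> P2_cost t (v, \<alpha>)"
      using to1[of "(v, \<alpha>)"] opt by (auto simp: is_arg_min_def)
    \<comment> \<open>The costs increase weakly along \<open>h\<close>,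
      \<open>(v, \<alpha>)\<close>, \<open>?\<Phi> h'\<close>, \<open>h'\<close>.\<close>
    have "P1_cost t vbar f h \<le> P1_cost t vbar f h'" if "P1_feasible vbar f x h'" for h'
      using h(3) to2[OF that] opt unfolding is_arg_min_linorder by (meson order_trans)
    then show ?thesis using h by (auto simp: is_arg_min_linorder)
  qed
  ultimately show ?thesis by blast
qed

end
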